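(* Let $B$ be an $N \times N$ nonnegative matrix. Then $B$ is strongly infinitely divisible if and only if there exists an $N\times N$ $Z$-matrix $Q$ such that $e^{-Q}=B$.
   Context: Matrices are real and square. A matrix is nonnegative if all its entries are $\geq 0$. A $Z$-matrix is a (real square) matrix whose off-diagonal entries are all $\leq 0$. A nonnegative matrix $B$ is infinitely divisible if there exists a sequence of nonnegative matrices $\{K_n\}_{n=1}^{\infty}$ such that $(K_n)^n = B$ for every $n\geq 1$; it is strongly infinitely divisible if in addition $\det(B)>0$. Here $e^{-Q}$ is the matrix exponential. *)

theory Defs
  imports "HOL-Analysis.Analysis"
begin

text \<open>
  The overloaded \<open>*\<close> and \<open>^\<close> on \<open>real ^ 'n ^ 'n\<close> act componentwise, so powers with respect to
  the matrix product \<open>**\<close> need a definition of their own.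
\<close>

primrec matpow :: "real ^ 'n ^ 'n \<Rightarrow> nat \<Rightarrow> real ^ 'n ^ 'n" where
  "matpow A 0 = mat 1"
| "matpow A (Suc k) = A ** matpow A k"

text \<open>
  For the same reason the library's \<open>exp\<close> is of no use here. The series below converges
  for every matrix; see \<open>summable_mat_exp\<close>.
\<close>

definition mat_exp :: "real ^ 'n ^ 'n \<Rightarrow> real ^ 'n ^ 'n" where
  "mat_exp A = (\<Sum>k. (1 / fact k) *\<^sub>R matpow A k)"

definition nonneg_mat :: "real ^ 'n ^ 'n \<Rightarrow> bool" where
  "nonneg_mat A \<longleftrightarrow> (\<forall>i j. 0 \<le> A $ i $ j)"

definition Z_matrix :: "real ^ 'n ^ 'n \<Rightarrow> bool" where
  "Z_matrix A \<longleftrightarrow> (\<forall>i j. i \<noteq> j \<longrightarrow> A $ i $ j \<le> 0)"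

definition infinitely_divisible :: "real ^ 'n ^ 'n \<Rightarrow> bool" where
  "infinitely_divisible B \<longleftrightarrow>
     nonneg_mat B \<and>
     (\<exists>K :: nat \<Rightarrow> real ^ 'n ^ 'n. \<forall>n\<ge>1. nonneg_mat (K n) \<and> matpow (K n) n = B)"

definition strongly_infinitely_divisible :: "real ^ 'n ^ 'n \<Rightarrow> bool" where
  "strongly_infinitely_divisible B \<longleftrightarrow> infinitely_divisible B \<and> det B > 0"

lemma abs_matpow_le:
  fixes A :: "real ^ 'n ^ 'n"
  assumes "\<And>i j. \<bar>A $ i $ j\<bar> \<le> c"
  shows "\<bar>matpow A k $ i $ j\<bar> \<le> (real CARD('n) * c) ^ k"
proof (induction k arbitrary: i j)
  case 0
  then show ?case by (simp add: mat_def)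
next
  case (Suc k)
  have c: "0 \<le> c" using assms[of i i] by linarith
  have "\<bar>matpow A (Suc k) $ i $ j\<bar> \<le> (\<Sum>l\<in>UNIV. \<bar>A $ i $ l * matpow A k $ l $ j\<bar>)"
    by (simp add: matrix_matrix_mult_def sum_abs)
  also have "\<dots> \<le> (\<Sum>l\<in>(UNIV :: 'n set). c * (real CARD('n) * c) ^ k)"
    unfolding abs_mult by (intro sum_mono mult_mono assms Suc.IH c) auto
  finally show ?case by (simp add: mult_ac)
qed

lemma summable_mat_exp:
  fixes A :: "real ^ 'n ^ 'n"
  shows "summable (\<lambda>k. (1 / fact k) *\<^sub>R matpow A k)"
proof -
  define c where "c = norm A"
  have c: "\<bar>A $ i $ j\<bar> \<le> c" for i j
    unfolding c_def
    by (metis Finite_Cartesian_Product.norm_nth_le order_trans real_norm_def)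
  define r where "r = real CARD('n) * c"
  have bound: "norm (matpow A k) \<le> real CARD('n) * (real CARD('n) * r ^ k)" for k
  proof -
    have "norm (matpow A k) \<le> (\<Sum>i\<in>UNIV. norm (matpow A k $ i))"
      unfolding norm_vec_def[of "matpow A k"] by (rule L2_set_le_sum) auto
    also have "\<dots> \<le> (\<Sum>i\<in>(UNIV :: 'n set). \<Sum>j\<in>(UNIV :: 'n set). \<bar>matpow A k $ i $ j\<bar>)"
      by (intro sum_mono norm_le_l1_cart)
    also have "\<dots> \<le> (\<Sum>i\<in>(UNIV :: 'n set). \<Sum>j\<in>(UNIV :: 'n set). r ^ k)"
      unfolding r_def by (intro sum_mono abs_matpow_le c)
    finally show ?thesis by simp
  qed
  show ?thesis
  proof (rule summable_comparison_test')
    show "summable (\<lambda>k. real CARD('n) * (real CARD('n) * (inverse (fact k) * r ^ k)))"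
      by (intro summable_mult summable_exp)
    show "norm ((1 / fact k) *\<^sub>R matpow A k)
        \<le> real CARD('n) * (real CARD('n) * (inverse (fact k) * r ^ k))" if "k \<ge> 0" for k
      using mult_left_mono[OF bound[of k], of "inverse (fact k)"]
      by (simp add: divide_inverse mult_ac)
  qed
qed

end

theory Submission
  imports Defs "HOL-Combinatorics.Cycles"
begin

text \<open>
  If \<open>Q\<close> is a \<open>Z\<close>-matrix, then \<open>1 - Q / n\<close> is nonnegative for large \<open>n\<close>, hence so is the limit
  \<open>mat_exp (- Q)\<close> of its \<open>n\<close>-th powers. The same applies to \<open>Q / n\<close>, whose exponential is an \<open>n\<close>-th root
  of \<open>mat_exp (- Q)\<close>; and the exponential of a real matrix has positive determinant, being an
  invertible square (\<open>strongly_infinitely_divisible_mat_exp\<close>).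

  Conversely, a logarithm of \<open>B\<close> should be a limit of \<open>n * (R - 1)\<close> for \<open>n\<close>-th roots \<open>R\<close> of \<open>B\<close>. By
  \<open>mat_exp_limit\<close> it suffices that these matrices are bounded: a limit point \<open>L\<close> then satisfies
  \<open>mat_exp L = B\<close>, and \<open>- L\<close> is a \<open>Z\<close>-matrix because the entries of \<open>R\<close> are nonnegative. The bound
  comes in three stages.

  The roots must first be kept in a compact set. Choose \<open>D\<close> such that the \<open>D\<close>-th power of every
  permutation of the indices is the identity, and take for \<open>R\<close> the \<open>D\<close>-th power of a nonnegative root
  of order \<open>D * n\<close>. As \<open>det B > 0\<close>, some permutation product in the determinant of that root is not
  small, and in the \<open>D\<close>-th power this permutation contributes to the diagonal. Thus all powers of \<open>R\<close>
  up to order \<open>n\<close> have diagonals bounded away from zero, and then also bounded entries, uniformly in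
  \<open>n\<close> (\<open>powers_of_roots_are_tame\<close>).

  Next, such roots tend to the identity (\<open>tame_roots_near_one\<close>). A limit point generates a
  relatively compact semigroup of invertible nonnegative matrices, so its inverse is nonnegative too;
  together with the control over diagonal and determinant this leaves only the identity
  (\<open>eq_one_if_powers_tame\<close>).

  Finally, near the identity squaring a matrix almost doubles its distance from the identity. For
  orders \<open>n = 2 ^ l\<close>, going back from a fixed small distance through \<open>l\<close> halvings gives a distance
  of order \<open>1 / n\<close> (\<open>tame_dyadic_roots_bound\<close>).
\<close>

section \<open>Products and powers of matrices\<close>

text \<open>
  The norm of \<open>real ^ 'n ^ 'n\<close> is the Frobenius norm, so Cauchy-Schwarz makes it submultiplicative.
\<close>

lemma norm_matrix_mult_le:
  fixes A B :: "real ^ 'n ^ 'n"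
  shows "norm (A ** B) \<le> norm A * norm B"
proof -
  have sq: "(norm C)\<^sup>2 = (\<Sum>i\<in>UNIV. \<Sum>j\<in>UNIV. (C $ i $ j)\<^sup>2)" for C :: "real ^ 'n ^ 'n"
    by (simp add: norm_vec_def L2_set_def sum_nonneg)
  have "(norm (A ** B))\<^sup>2 = (\<Sum>i\<in>UNIV. \<Sum>j\<in>UNIV. (\<Sum>k\<in>UNIV. A $ i $ k * B $ k $ j)\<^sup>2)"
    by (simp add: sq matrix_matrix_mult_def)
  also have "\<dots> \<le> (\<Sum>i\<in>UNIV. \<Sum>j\<in>UNIV. (\<Sum>k\<in>UNIV. (A $ i $ k)\<^sup>2) * (\<Sum>k\<in>UNIV. (B $ k $ j)\<^sup>2))"
    by (intro sum_mono Cauchy_Schwarz_ineq_sum)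
  also have "\<dots> = (\<Sum>i\<in>UNIV. \<Sum>k\<in>UNIV. (A $ i $ k)\<^sup>2) * (\<Sum>j\<in>UNIV. \<Sum>k\<in>UNIV. (B $ k $ j)\<^sup>2)"
    by (simp add: sum_product)
  also have "(\<Sum>j\<in>UNIV. \<Sum>k\<in>UNIV. (B $ k $ j)\<^sup>2) = (norm B)\<^sup>2"
    unfolding sq by (rule sum.swap)
  finally have "(norm (A ** B))\<^sup>2 \<le> (norm A * norm B)\<^sup>2"
    by (simp add: sq power_mult_distrib)
  then show ?thesis
    by (rule power2_le_imp_le) simp
qed

lemma bounded_bilinear_matrix_mult:
  "bounded_bilinear ((**) :: real ^ 'n ^ 'n \<Rightarrow> real ^ 'n ^ 'n \<Rightarrow> real ^ 'n ^ 'n)"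
proof
  show "\<exists>K. \<forall>(A :: real ^ 'n ^ 'n) (B :: real ^ 'n ^ 'n). norm (A ** B) \<le> norm A * norm B * K"
    by (intro exI[of _ 1]) (simp add: norm_matrix_mult_le)
qed (simp_all add: matrix_matrix_mult_def vec_eq_iff sum.distrib sum_distrib_left distrib_left
  distrib_right mult_ac)

interpretation matrix_mult: bounded_bilinear
  "(**) :: real ^ 'n ^ 'n \<Rightarrow> real ^ 'n ^ 'n \<Rightarrow> real ^ 'n ^ 'n"
  by (rule bounded_bilinear_matrix_mult)

lemma matpow_add: "matpow A (m + n) = matpow A m ** matpow A n"
  by (induction m) (auto simp: matrix_mul_assoc)

lemma matpow_mult: "matpow A (m * n) = matpow (matpow A m) n"
  by (induction n) (auto simp: matpow_add)

lemma det_matpow: "det (matpow A n) = det A ^ n"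
  by (induction n) (auto simp: det_mul)

lemma matpow_mat_1 [simp]: "matpow (mat 1) n = mat 1"
  by (induction n) auto

lemma tendsto_matpow:
  assumes "(f \<longlongrightarrow> A) F"
  shows "((\<lambda>x. matpow (f x) n) \<longlongrightarrow> matpow A n) F"
  by (induction n) (auto intro: matrix_mult.tendsto assms)

lemma tendsto_det:
  fixes A :: "real ^ 'n ^ 'n"
  assumes "(f \<longlongrightarrow> A) F"
  shows "((\<lambda>x. det (f x)) \<longlongrightarrow> det A) F"
  unfolding det_def by (intro tendsto_intros assms)

lemma matpow_commute:
  assumes "A ** B = B ** A"
  shows "matpow A n ** B = B ** matpow A n"
proof (induction n)
  case (Suc n)
  have "matpow A (Suc n) ** B = A ** (matpow A n ** B)"
    by (simp add: matrix_mul_assoc)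
  also have "\<dots> = B ** matpow A (Suc n)"
    by (simp add: Suc matrix_mul_assoc assms)
  finally show ?case .
qed auto

lemma matpow_prod:
  assumes "A ** B = B ** A"
  shows "matpow (A ** B) n = matpow A n ** matpow B n"
proof (induction n)
  case (Suc n)
  have "matpow (A ** B) (Suc n) = A ** (B ** matpow A n) ** matpow B n"
    by (simp add: Suc matrix_mul_assoc)
  also have "B ** matpow A n = matpow A n ** B"
    by (simp add: assms matpow_commute)
  finally show ?case
    by (simp add: matrix_mul_assoc)
qed auto

lemma nonneg_mat_mult: "nonneg_mat A \<Longrightarrow> nonneg_mat B \<Longrightarrow> nonneg_mat (A ** B)"
  unfolding nonneg_mat_def matrix_matrix_mult_def by (auto intro!: sum_nonneg)

lemma nonneg_mat_matpow: "nonneg_mat A \<Longrightarrow> nonneg_mat (matpow A n)"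
  by (induction n) (auto simp: nonneg_mat_mult, auto simp: nonneg_mat_def mat_def)

lemma mult_entry_ge:
  assumes "nonneg_mat A" "nonneg_mat B"
  shows "A $ i $ k * B $ k $ j \<le> (A ** B) $ i $ j"
proof -
  have "A $ i $ k * B $ k $ j \<le> (\<Sum>k\<in>UNIV. A $ i $ k * B $ k $ j)"
    using assms by (intro member_le_sum) (auto simp: nonneg_mat_def)
  then show ?thesis
    by (simp add: matrix_matrix_mult_def)
qed

lemma matpow_diag_ge:
  assumes "nonneg_mat A"
  shows "(A $ i $ i) ^ n \<le> matpow A n $ i $ i"
proof (induction n)
  case (Suc n)
  have "A $ i $ i ^ Suc n \<le> A $ i $ i * matpow A n $ i $ i"
    using Suc assms by (auto simp: nonneg_mat_def intro: mult_left_mono)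
  also have "\<dots> \<le> (A ** matpow A n) $ i $ i"
    by (intro mult_entry_ge assms nonneg_mat_matpow)
  finally show ?case by simp
qed (auto simp: mat_def)

section \<open>The exponential as a limit of powers\<close>

lemma matpow_scaleR: "matpow (c *\<^sub>R A) k = c ^ k *\<^sub>R matpow A k"
  by (induction k) (auto simp: matrix_mult.scaleR_left matrix_mult.scaleR_right)

lemma matpow_one_plus:
  "matpow (mat 1 + X) n = (\<Sum>k\<le>n. real (n choose k) *\<^sub>R matpow X k)"
proof (induction n)
  case (Suc n)
  have "(\<Sum>k\<le>Suc n. real (Suc n choose k) *\<^sub>R matpow X k)
      = matpow X 0 + (\<Sum>k\<le>n. real (n choose Suc k) *\<^sub>R matpow X (Suc k))
        + (\<Sum>k\<le>n. real (n choose k) *\<^sub>R matpow X (Suc k))"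
    by (simp add: sum.atMost_Suc_shift scaleR_add_left sum.distrib algebra_simps del: sum.atMost_Suc)
  also have "matpow X 0 + (\<Sum>k\<le>n. real (n choose Suc k) *\<^sub>R matpow X (Suc k))
      = (\<Sum>k\<le>Suc n. real (n choose k) *\<^sub>R matpow X k)"
    by (subst sum.atMost_Suc_shift) simp
  also have "\<dots> = matpow (mat 1 + X) n"
    by (simp add: Suc)
  also have "(\<Sum>k\<le>n. real (n choose k) *\<^sub>R matpow X (Suc k)) = X ** matpow (mat 1 + X) n"
    by (simp add: Suc matrix_mult.sum_right matrix_mult.scaleR_right)
  finally show ?case
    by (simp add: matrix_mult.add_left)
qed auto

lemma binomial_over_power_limit:
  "(\<lambda>n. real (n choose k) / real n ^ k) \<longlonglongrightarrow> 1 / fact k"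
proof -
  have "(\<lambda>n. (\<Prod>i = 0..<k. 1 - real i / real n) / fact k) \<longlonglongrightarrow> (\<Prod>i = 0..<k. 1 - 0) / fact k"
    by (intro tendsto_intros lim_const_over_n) auto
  moreover have "\<forall>\<^sub>F n in sequentially.
      (\<Prod>i = 0..<k. 1 - real i / real n) / fact k = real (n choose k) / real n ^ k"
    using eventually_gt_at_top[of 0]
  proof eventually_elim
    case (elim n)
    have "(\<Prod>i = 0..<k. 1 - real i / real n) = (\<Prod>i = 0..<k. (real n - real i) / real n)"
      using elim by (intro prod.cong) (auto simp: field_simps)
    also have "\<dots> = (\<Prod>i = 0..<k. real n - real i) / real n ^ k"
      by (simp add: prod_dividef)
    finally show ?case
      by (simp add: binomial_gbinomial gbinomial_prod_rev)
  qed
  ultimately show ?thesis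
    by (simp add: tendsto_cong)
qed

lemma mat_exp_nth:
  fixes A :: "real ^ 'n ^ 'n"
  shows "mat_exp A $ i $ j = (\<Sum>k. 1 / fact k * matpow A k $ i $ j)"
proof -
  have "bounded_linear (\<lambda>A :: real ^ 'n ^ 'n. A $ i $ j)"
    using bounded_linear_compose[OF bounded_linear_vec_nth bounded_linear_vec_nth] .
  from bounded_linear.suminf[OF this summable_mat_exp[of A]]
  show ?thesis
    by (simp add: mat_exp_def)
qed

text \<open>
  The one analytic fact about the exponential that is needed. By the binomial theorem the power is a
  series in \<open>matpow (A n) k\<close> whose coefficients tend to \<open>1 / fact k\<close> and never exceed it, so Tannery's
  theorem applies to each entry. That \<open>A\<close> may vary and that the exponents \<open>p\<close> are arbitrary lets
  the same lemma recover the exponential from a subsequence of dyadic roots and prove the functional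
  equations below without manipulating double series.
\<close>

lemma mat_exp_limit:
  fixes A :: "nat \<Rightarrow> real ^ 'n ^ 'n"
  assumes lim: "A \<longlonglongrightarrow> L" and p: "filterlim p at_top sequentially"
  shows "(\<lambda>n. matpow (mat 1 + (1 / real (p n)) *\<^sub>R A n) (p n)) \<longlonglongrightarrow> mat_exp L"
proof (intro vec_tendstoI)
  fix i j :: 'n
  obtain R where R: "\<And>n. norm (A n) \<le> R"
    using convergent_imp_Bseq[OF convergentI[OF lim]] by (auto simp: Bseq_def)
  have bound: "\<bar>A n $ p $ q\<bar> \<le> R" for n p q
    using R[of n] by (metis Finite_Cartesian_Product.norm_nth_le order_trans real_norm_def)
  define r where "r = real CARD('n) * R"
  define a where "a k n = real (p n choose k) / real (p n) ^ k * matpow (A n) k $ i $ j" for k n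
  have choose: "real (n choose k) / real n ^ k \<le> 1 / fact k" for n k
  proof -
    have "real (n choose k) * fact k \<le> real n ^ k"
      using binomial_fact_pow[of n k] by (metis of_nat_fact of_nat_le_iff of_nat_mult of_nat_power)
    then show ?thesis
      by (cases "n = 0 \<and> k > 0") (auto simp: field_simps divide_simps)
  qed
  have "(\<lambda>n. \<Sum>k. a k n) \<longlonglongrightarrow> (\<Sum>k. 1 / fact k * matpow L k $ i $ j)"
  proof (rule conjunct2[OF conjunct2[OF tannerys_theorem]])
    show "(\<lambda>n. a k n) \<longlonglongrightarrow> 1 / fact k * matpow L k $ i $ j" for k
      unfolding a_def
      by (intro tendsto_intros tendsto_matpow lim filterlim_compose[OF binomial_over_power_limit p])
    have "norm (a k n) \<le> inverse (fact k) * r ^ k" for k n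
      unfolding a_def r_def real_norm_def abs_mult
      using choose[of "p n" k] abs_matpow_le[OF bound, where k = k and i = i and j = j]
      by (intro mult_mono) (auto simp: divide_inverse)
    then show "\<forall>\<^sub>F (k, n) in at_top \<times>\<^sub>F at_top. norm (a k n) \<le> inverse (fact k) * r ^ k"
      by (intro always_eventually) auto
  qed (auto intro: summable_exp)
  moreover have "matpow (mat 1 + (1 / real (p n)) *\<^sub>R A n) (p n) $ i $ j = (\<Sum>k. a k n)" for n
  proof -
    have "(\<Sum>k. a k n) = (\<Sum>k\<le>p n. a k n)"
      by (rule suminf_finite) (auto simp: a_def not_le)
    then show ?thesis
      unfolding matpow_one_plus matpow_scaleR by (simp add: a_def power_divide)
  qed
  ultimately show "(\<lambda>n. matpow (mat 1 + (1 / real (p n)) *\<^sub>R A n) (p n) $ i $ j)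
      \<longlonglongrightarrow> mat_exp L $ i $ j"
    by (simp add: mat_exp_nth)
qed

text \<open>
  Both sides are the limit of \<open>(1 + A / (l * n)) ^ (l * n)\<close> as \<open>l\<close> grows.
\<close>

lemma matpow_mat_exp:
  assumes "n > 0"
  shows "matpow (mat_exp ((1 / real n) *\<^sub>R A)) n = mat_exp A"
proof (rule LIMSEQ_unique)
  define C where "C = (1 / real n) *\<^sub>R A"
  show "(\<lambda>l. matpow (matpow (mat 1 + (1 / real l) *\<^sub>R C) l) n) \<longlonglongrightarrow> matpow (mat_exp C) n"
    by (intro tendsto_matpow mat_exp_limit tendsto_const filterlim_ident)
  have "strict_mono (\<lambda>l. l * n)"
    using assms by (auto simp: strict_mono_def)
  then have "(\<lambda>l. matpow (mat 1 + (1 / real (l * n)) *\<^sub>R A) (l * n)) \<longlonglongrightarrow> mat_exp A"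
    by (intro mat_exp_limit tendsto_const filterlim_subseq)
  then show "(\<lambda>l. matpow (matpow (mat 1 + (1 / real l) *\<^sub>R C) l) n) \<longlonglongrightarrow> mat_exp A"
    by (simp add: matpow_mult C_def)
qed

lemma mat_exp_0: "mat_exp 0 = mat 1"
  using LIMSEQ_unique[OF mat_exp_limit[OF tendsto_const filterlim_ident, of 0], of "mat 1"] by simp

text \<open>
  The product of \<open>(1 + A / n) ^ n\<close> and \<open>(1 - A / n) ^ n\<close> is \<open>(1 - A\<^sup>2 / n\<^sup>2) ^ n\<close>. With the
  matrices \<open>- A\<^sup>2 / n\<close>, which tend to \<open>0\<close>, in the role of \<open>A n\<close>, \<open>mat_exp_limit\<close> gives
  \<open>mat_exp 0\<close>.
\<close>

lemma mat_exp_mult_minus: "mat_exp A ** mat_exp (- A) = mat 1"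
proof (rule LIMSEQ_unique)
  define X where "X n = (1 / real n) *\<^sub>R A" for n
  show "(\<lambda>n. matpow (mat 1 + X n) n ** matpow (mat 1 + (1 / real n) *\<^sub>R (- A)) n)
      \<longlonglongrightarrow> mat_exp A ** mat_exp (- A)"
    unfolding X_def by (intro matrix_mult.tendsto mat_exp_limit tendsto_const filterlim_ident)
  have "matpow (mat 1 + X n) n ** matpow (mat 1 + (1 / real n) *\<^sub>R (- A)) n
      = matpow (mat 1 + (1 / real n) *\<^sub>R (- (1 / real n)) *\<^sub>R (A ** A)) n" for n
  proof -
    have "matpow (mat 1 + X n) n ** matpow (mat 1 + (1 / real n) *\<^sub>R (- A)) n
        = matpow (mat 1 + X n) n ** matpow (mat 1 - X n) n"
      by (simp add: X_def)
    also have "\<dots> = matpow ((mat 1 + X n) ** (mat 1 - X n)) n"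
      by (rule matpow_prod[symmetric])
        (simp add: matrix_mult.add_left matrix_mult.add_right matrix_mult.diff_left matrix_mult.diff_right)
    also have "(mat 1 + X n) ** (mat 1 - X n) = mat 1 - X n ** X n"
      by (simp add: matrix_mult.add_left matrix_mult.diff_right)
    finally show ?thesis
      by (simp add: X_def matrix_mult.scaleR_left matrix_mult.scaleR_right)
  qed
  moreover have "(\<lambda>n. matpow (mat 1 + (1 / real n) *\<^sub>R (- (1 / real n)) *\<^sub>R (A ** A)) n)
      \<longlonglongrightarrow> mat_exp (- 0 *\<^sub>R (A ** A))"
    by (intro mat_exp_limit tendsto_intros lim_const_over_n filterlim_ident)
  ultimately show "(\<lambda>n. matpow (mat 1 + X n) n ** matpow (mat 1 + (1 / real n) *\<^sub>R (- A)) n)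
      \<longlonglongrightarrow> mat 1"
    by (simp add: mat_exp_0)
qed

text \<open>
  The exponential is invertible and is the square of \<open>mat_exp (A / 2)\<close>.
\<close>

lemma det_mat_exp_pos: "det (mat_exp A) > 0"
proof -
  have "det (mat_exp A) = det (mat_exp ((1 / real 2) *\<^sub>R A)) ^ 2"
    using matpow_mat_exp[of 2 A] by (metis det_matpow pos2)
  moreover have "det (mat_exp A) * det (mat_exp (- A)) = 1"
    by (metis mat_exp_mult_minus det_mul det_I)
  ultimately show ?thesis
    by (metis mult_eq_0_iff zero_less_power2 zero_neq_one zero_power2)
qed

lemma nonneg_mat_limit:
  assumes "f \<longlonglongrightarrow> A" "\<forall>\<^sub>F n in sequentially. nonneg_mat (f n)"
  shows "nonneg_mat A"
  unfolding nonneg_mat_def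
proof (intro allI)
  fix i j
  have "(\<lambda>n. f n $ i $ j) \<longlonglongrightarrow> A $ i $ j"
    by (intro tendsto_intros assms)
  moreover have "\<forall>\<^sub>F n in sequentially. 0 \<le> f n $ i $ j"
    using assms(2) by eventually_elim (auto simp: nonneg_mat_def)
  ultimately show "0 \<le> A $ i $ j"
    by (rule tendsto_lowerbound) auto
qed

text \<open>
  For large \<open>n\<close> the matrix \<open>1 - Q / n\<close> is already nonnegative: dividing by \<open>n\<close> makes the diagonal of
  \<open>Q\<close> harmless, and off the diagonal the signs are right.
\<close>

lemma nonneg_mat_exp_minus:
  fixes Q :: "real ^ 'n ^ 'n"
  assumes "Z_matrix Q"
  shows "nonneg_mat (mat_exp (- Q))"
proof (rule nonneg_mat_limit)
  show "(\<lambda>n. matpow (mat 1 + (1 / real n) *\<^sub>R (- Q)) n) \<longlonglongrightarrow> mat_exp (- Q)"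
    by (intro mat_exp_limit tendsto_const filterlim_ident)
  obtain n0 where n0: "norm Q \<le> real n0"
    using real_arch_simple by blast
  show "\<forall>\<^sub>F n in sequentially. nonneg_mat (matpow (mat 1 + (1 / real n) *\<^sub>R (- Q)) n)"
    using eventually_gt_at_top[of n0]
  proof eventually_elim
    case (elim n)
    have "nonneg_mat (mat 1 + (1 / real n) *\<^sub>R (- Q))"
      unfolding nonneg_mat_def
    proof (intro allI)
      fix i j
      have "\<bar>Q $ i $ j\<bar> \<le> norm Q"
        by (metis Finite_Cartesian_Product.norm_nth_le order_trans real_norm_def)
      then have "Q $ i $ j \<le> real n"
        using n0 elim by linarith
      then show "0 \<le> (mat 1 + (1 / real n) *\<^sub>R (- Q)) $ i $ j"
        using elim assms by (auto simp: mat_def Z_matrix_def divide_nonpos_nonneg)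
    qed
    then show ?case
      by (rule nonneg_mat_matpow)
  qed
qed

lemma strongly_infinitely_divisible_mat_exp:
  assumes "Z_matrix Q"
  shows "strongly_infinitely_divisible (mat_exp (- Q))"
proof -
  have "nonneg_mat (mat_exp ((1 / real n) *\<^sub>R (- Q)))" for n
    using nonneg_mat_exp_minus[of "(1 / real n) *\<^sub>R Q"] assms
    by (simp add: Z_matrix_def divide_nonpos_nonneg)
  then have "\<forall>n\<ge>1. nonneg_mat (mat_exp ((1 / real n) *\<^sub>R (- Q)))
      \<and> matpow (mat_exp ((1 / real n) *\<^sub>R (- Q))) n = mat_exp (- Q)"
    using matpow_mat_exp[of _ "- Q"] by simp
  then show ?thesis
    unfolding strongly_infinitely_divisible_def infinitely_divisible_def
    using nonneg_mat_exp_minus[OF assms] det_mat_exp_pos[of "- Q"]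
    by (blast intro: exI[of _ "\<lambda>n. mat_exp ((1 / real n) *\<^sub>R (- Q))"])
qed

section \<open>Uniform bounds for nonnegative roots\<close>

text \<open>
  Such an exponent turns every walk that follows a permutation into a closed walk, whatever the
  permutation is.
\<close>

lemma common_permutation_exponent:
  obtains D where "D > 0" "\<And>\<sigma>. \<sigma> permutes (UNIV :: 'n :: finite set) \<Longrightarrow> \<sigma> ^^ D = id"
proof -
  let ?P = "{\<sigma>. \<sigma> permutes (UNIV :: 'n set)}"
  have "\<exists>n. \<sigma> ^^ n = id \<and> n > 0" if "\<sigma> \<in> ?P" for \<sigma>
  proof -
    have "permutation \<sigma>"
      using that unfolding permutation_permutes by auto
    then show ?thesis
      by (rule permutation_is_nilpotent) blast
  qed
  then obtain d where d: "\<And>\<sigma>. \<sigma> \<in> ?P \<Longrightarrow> \<sigma> ^^ d \<sigma> = id" "\<And>\<sigma>. \<sigma> \<in> ?P \<Longrightarrow> d \<sigma> > 0"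
    by metis
  have fin: "finite ?P"
    by (simp add: finite_permutations)
  have "\<sigma> ^^ prod d ?P = id" if "\<sigma> \<in> ?P" for \<sigma>
  proof -
    have "prod d ?P = d \<sigma> * prod d (?P - {\<sigma>})"
      by (rule prod.remove[OF fin that])
    then show ?thesis
      using d(1)[OF that] by (simp flip: funpow_mult)
  qed
  moreover have "prod d ?P > 0"
    using d(2) by (simp add: prod_pos)
  ultimately show ?thesis
    using that[of "prod d ?P"] by blast
qed

text \<open>
  An entry of \<open>matpow A n\<close> sums the weights of all walks of length \<open>n\<close>; with nonnegative weights
  each single walk is a lower bound.
\<close>

lemma matpow_walk:
  assumes "nonneg_mat A"
  shows "(\<Prod>t<n. A $ w t $ w (Suc t)) \<le> matpow A n $ w 0 $ w n"
proof (induction n)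
  case (Suc n)
  have "(\<Prod>t<Suc n. A $ w t $ w (Suc t)) \<le> matpow A n $ w 0 $ w n * A $ w n $ w (Suc n)"
    using Suc assms by (auto simp: nonneg_mat_def intro: mult_right_mono)
  also have "\<dots> \<le> (matpow A n ** A) $ w 0 $ w (Suc n)"
    by (intro mult_entry_ge assms nonneg_mat_matpow)
  finally show ?case
    using matpow_add[of A n 1] by simp
qed (auto simp: mat_def)

text \<open>
  The determinant is a signed sum of \<open>fact CARD('n)\<close> such products, so one of them has at least the
  average size.
\<close>

lemma det_le_permutation_product:
  fixes M :: "real ^ 'n ^ 'n"
  assumes "nonneg_mat M"
  obtains \<sigma> where "\<sigma> permutes UNIV" "\<bar>det M\<bar> / fact CARD('n) \<le> (\<Prod>i\<in>UNIV. M $ i $ \<sigma> i)"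
proof -
  let ?P = "{\<sigma>. \<sigma> permutes (UNIV :: 'n set)}"
  have "\<exists>\<sigma>\<in>?P. \<bar>det M\<bar> / fact CARD('n) \<le> (\<Prod>i\<in>UNIV. M $ i $ \<sigma> i)"
  proof (rule ccontr)
    assume "\<not> ?thesis"
    then have less: "(\<Prod>i\<in>UNIV. M $ i $ \<sigma> i) < \<bar>det M\<bar> / fact CARD('n)" if "\<sigma> \<in> ?P" for \<sigma>
      using that by force
    have "\<bar>det M\<bar> \<le> (\<Sum>\<sigma>\<in>?P. \<bar>of_int (sign \<sigma>) * (\<Prod>i\<in>UNIV. M $ i $ \<sigma> i)\<bar>)"
      unfolding det_def by (rule sum_abs)
    also have "\<dots> = (\<Sum>\<sigma>\<in>?P. \<Prod>i\<in>UNIV. M $ i $ \<sigma> i)"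
      using assms by (intro sum.cong) (auto simp: abs_mult abs_prod nonneg_mat_def sign_def)
    also have "\<dots> < (\<Sum>\<sigma>\<in>?P. \<bar>det M\<bar> / fact CARD('n))"
      by (intro sum_strict_mono less) (auto simp: finite_permutations intro: permutes_id)
    also have "\<dots> = \<bar>det M\<bar>"
      by (simp add: card_permutations)
    finally show False by simp
  qed
  then show ?thesis
    using that by blast
qed

text \<open>
  Starting at \<open>i\<close> and following a permutation \<open>\<sigma>\<close> with a large product for \<open>D\<close> steps is a closed
  walk, whose weight \<open>P i\<close> bounds the \<open>i\<close>-th diagonal entry of \<open>matpow M D\<close> from below. The product of
  all \<open>P i\<close> is the \<open>D\<close>-th power of the product along \<open>\<sigma>\<close>. As no \<open>P j\<close> exceeds \<open>b\<close>, none of them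
  can be small. Passing to the power \<open>D\<close> is essential: a nonnegative matrix with large determinant may
  have zero diagonal.
\<close>

lemma diag_ge_det:
  fixes M :: "real ^ 'n ^ 'n"
  assumes M: "nonneg_mat M"
    and D: "\<And>\<sigma>. \<sigma> permutes (UNIV :: 'n set) \<Longrightarrow> \<sigma> ^^ D = id"
    and b: "b \<ge> 0" "\<And>j. matpow M D $ j $ j \<le> b"
  shows "(\<bar>det M\<bar> / fact CARD('n)) ^ D \<le> matpow M D $ i $ i * b ^ (CARD('n) - 1)"
proof -
  obtain \<sigma> where \<sigma>: "\<sigma> permutes UNIV" "\<bar>det M\<bar> / fact CARD('n) \<le> (\<Prod>i\<in>UNIV. M $ i $ \<sigma> i)"
    using det_le_permutation_product[OF M] .
  define P where "P i = (\<Prod>t<D. M $ (\<sigma> ^^ t) i $ (\<sigma> ^^ Suc t) i)" for i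
  have P_le: "P i \<le> matpow M D $ i $ i" for i
    using matpow_walk[OF M, where n = D and w = "\<lambda>t. (\<sigma> ^^ t) i"] D[OF \<sigma>(1)]
    by (simp add: P_def)
  have P_nonneg: "P i \<ge> 0" for i
    unfolding P_def using M by (intro prod_nonneg) (auto simp: nonneg_mat_def)
  have "(\<Prod>i\<in>UNIV. P i) = (\<Prod>t<D. \<Prod>i\<in>UNIV. M $ (\<sigma> ^^ t) i $ \<sigma> ((\<sigma> ^^ t) i))"
    unfolding P_def by (subst prod.swap) simp
  \<comment> \<open>at every time the walks from the different starting points occupy all indices\<close>
  also have "\<dots> = (\<Prod>t<D. \<Prod>i\<in>UNIV. M $ i $ \<sigma> i)"
  proof (rule prod.cong[OF refl])
    fix t
    have "(\<sigma> ^^ t) permutes UNIV"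
      using permutes_funpow \<sigma>(1) by blast
    then show "(\<Prod>i\<in>UNIV. M $ (\<sigma> ^^ t) i $ \<sigma> ((\<sigma> ^^ t) i)) = (\<Prod>i\<in>UNIV. M $ i $ \<sigma> i)"
      by (intro prod.reindex_bij_betw permutes_imp_bij)
  qed
  finally have "(\<Prod>i\<in>UNIV. P i) = (\<Prod>i\<in>UNIV. M $ i $ \<sigma> i) ^ D"
    by simp
  then have "(\<bar>det M\<bar> / fact CARD('n)) ^ D \<le> (\<Prod>i\<in>UNIV. P i)"
    using \<sigma>(2) by (simp add: power_mono)
  also have "\<dots> = P i * (\<Prod>j\<in>UNIV - {i}. P j)"
    by (rule prod.remove) auto
  also have "(\<Prod>j\<in>UNIV - {i}. P j) \<le> (\<Prod>j\<in>UNIV - {i}. b)"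
    using P_nonneg P_le b(2) by (intro prod_mono) (auto intro: order_trans)
  also have "(\<Prod>j\<in>UNIV - {i}. b) = b ^ (CARD('n) - 1)"
    by simp
  also have "P i * b ^ (CARD('n) - 1) \<le> matpow M D $ i $ i * b ^ (CARD('n) - 1)"
    using P_le b by (intro mult_right_mono) auto
  finally show ?thesis
    using P_nonneg by (simp add: mult_left_mono)
qed

text \<open>
  Matrices that are tame for fixed constants form a compact set, and \<open>c > 0\<close> keeps their diagonals
  away from zero. A tame root keeps this property through all its powers up to \<open>B\<close>. The
  constants are parameters so that one choice can serve roots of every order.
\<close>

definition tame :: "real \<Rightarrow> real \<Rightarrow> real ^ 'n ^ 'n \<Rightarrow> bool" where
  "tame c C A \<longleftrightarrow> nonneg_mat A \<and> (\<forall>i j. A $ i $ j \<le> C) \<and> (\<forall>i. c \<le> A $ i $ i)"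

definition tame_root :: "real \<Rightarrow> real \<Rightarrow> real ^ 'n ^ 'n \<Rightarrow> nat \<Rightarrow> real ^ 'n ^ 'n \<Rightarrow> bool" where
  "tame_root c C B n G \<longleftrightarrow> matpow G n = B \<and> (\<forall>a\<le>n. tame c C (matpow G a))"

lemma tame_root_matpow:
  assumes "tame_root c C B (m * n) G"
  shows "tame_root c C B m (matpow G n)"
proof -
  have "n * a \<le> m * n" if "a \<le> m" for a
    using that by simp
  then show ?thesis
    using assms unfolding tame_root_def by (metis matpow_mult mult.commute)
qed

text \<open>
  Why roots do not escape to infinity. In general they can: \<open>[[0, x], [1 / x, 0]]\<close> is a square root of
  the identity for every \<open>x > 0\<close>. The power \<open>D\<close> rules this out. With \<open>M = matpow K a\<close>, the
  diagonal of \<open>matpow M D\<close> is at most \<open>b\<close> because its \<open>n\<close>-th powers lie below the diagonal of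
  \<open>matpow B a\<close>, and \<open>\<bar>det M\<bar>\<close> is at least \<open>min 1 (det B)\<close>; so \<open>diag_ge_det\<close> bounds this diagonal
  from below. An off-diagonal entry of \<open>matpow K (D * a)\<close> times a diagonal entry of the complementary
  power \<open>matpow K (D * (n - a))\<close> is at most an entry of \<open>B\<close>, which bounds it from above.
\<close>

lemma powers_of_roots_are_tame:
  fixes B :: "real ^ 'n ^ 'n"
  assumes det: "det B > 0"
    and D: "D > 0" "\<And>\<sigma>. \<sigma> permutes (UNIV :: 'n set) \<Longrightarrow> \<sigma> ^^ D = id"
  obtains c C where "c > 0"
    "\<And>K n. n > 0 \<Longrightarrow> nonneg_mat K \<Longrightarrow> matpow K (D * n) = B \<Longrightarrow> tame_root c C B n (matpow K D)"
proof -
  have entry: "\<bar>B $ i $ j\<bar> \<le> norm B" for i j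
    by (metis Finite_Cartesian_Product.norm_nth_le order_trans real_norm_def)
  define b where "b = max 1 (real CARD('n) * norm B)"
  define d where "d = min 1 (det B)"
  define c where "c = (d / fact CARD('n)) ^ D / b ^ (CARD('n) - 1)"
  have d: "0 < d" "d \<le> 1" "d \<le> det B" and b: "b \<ge> 1"
    using det by (auto simp: d_def b_def)
  have c: "c > 0"
    using d b by (simp add: c_def)
  have B_pow: "matpow B a $ i $ i \<le> b ^ a" for a i
  proof -
    have "matpow B a $ i $ i \<le> (real CARD('n) * norm B) ^ a"
      using abs_matpow_le[OF entry, of a i i] by simp
    also have "\<dots> \<le> b ^ a"
      by (intro power_mono) (auto simp: b_def)
    finally show ?thesis .
  qed
  have "tame_root c (norm B / c) B n (matpow K D)"
    if n: "n > 0" and K: "nonneg_mat K" and root: "matpow K (D * n) = B" for K n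
  proof -
    have diag: "c \<le> matpow K (D * a) $ i $ i" if a: "a \<le> n" for a i
    proof -
      define M where "M = matpow K a"
      have M: "nonneg_mat M"
        using K by (simp add: M_def nonneg_mat_matpow)
      have KM: "matpow K (D * a) = matpow M D"
        unfolding M_def by (metis matpow_mult mult.commute)
      have "matpow M (D * n) = matpow B a"
        unfolding M_def root[symmetric] by (metis matpow_mult mult.commute)
      then have MB: "matpow (matpow M D) n = matpow B a"
        by (simp add: matpow_mult)
      have le_b: "matpow M D $ j $ j \<le> b" for j
      proof -
        have "(matpow M D $ j $ j) ^ n \<le> matpow B a $ j $ j"
          using matpow_diag_ge[OF nonneg_mat_matpow[OF M], of D j n] MB by simp
        also have "\<dots> \<le> b ^ a"
          by (rule B_pow)
        also have "\<dots> \<le> b ^ n"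
          using a b by (rule power_increasing)
        finally show ?thesis
          using nonneg_mat_matpow[OF M, of D] n b
          by (subst (asm) power_mono_iff) (auto simp: nonneg_mat_def)
      qed
      \<comment> \<open>since \<open>d \<le> 1\<close> and \<open>a \<le> D * n\<close>; so \<open>d\<close> works for all orders of the root at once\<close>
      have "d ^ (D * n) \<le> d ^ a"
        using D(1) a d by (intro power_decreasing) (auto intro: order_trans[of a n])
      also have "\<dots> \<le> det B ^ a"
        using d by (intro power_mono) auto
      also have "\<dots> = \<bar>det M\<bar> ^ (D * n)"
        using arg_cong[OF \<open>matpow M (D * n) = matpow B a\<close>, of "\<lambda>X. \<bar>det X\<bar>"] det
        by (simp add: det_matpow power_abs)
      finally have "d \<le> \<bar>det M\<bar>"
        using d D(1) n by (subst (asm) power_mono_iff) auto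
      then have "(d / fact CARD('n)) ^ D \<le> (\<bar>det M\<bar> / fact CARD('n)) ^ D"
        using d by (intro power_mono divide_right_mono) auto
      also have "\<dots> \<le> matpow M D $ i $ i * b ^ (CARD('n) - 1)"
        using b by (intro diag_ge_det M D(2) le_b) auto
      finally show ?thesis
        using b unfolding KM c_def by (simp add: divide_le_eq)
    qed
    have upper: "matpow K (D * a) $ i $ j \<le> norm B / c" if a: "a \<le> n" for a i j
    proof -
      have nonneg: "nonneg_mat (matpow K k)" for k
        by (intro nonneg_mat_matpow K)
      have "matpow K (D * a) $ i $ j * c \<le> matpow K (D * a) $ i $ j * matpow K (D * (n - a)) $ j $ j"
        using nonneg diag[of "n - a"] by (intro mult_left_mono) (auto simp: nonneg_mat_def)
      also have "\<dots> \<le> (matpow K (D * a) ** matpow K (D * (n - a))) $ i $ j"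
        by (intro mult_entry_ge nonneg)
      also have "matpow K (D * a) ** matpow K (D * (n - a)) = B"
        using a by (simp add: root flip: matpow_add distrib_left)
      also have "B $ i $ j \<le> norm B"
        using entry[of i j] by simp
      finally show ?thesis
        using c by (simp add: le_divide_eq)
    qed
    have "tame c (norm B / c) (matpow (matpow K D) a)" if "a \<le> n" for a
      unfolding tame_def matpow_mult[symmetric]
      using diag[OF that] upper[OF that] nonneg_mat_matpow[OF K] by blast
    then show ?thesis
      using root by (simp add: tame_root_def matpow_mult)
  qed
  then show ?thesis
    using that c by blast
qed

section \<open>Convergence of the roots to the identity\<close>

lemma tame_norm_le:
  fixes A :: "real ^ 'n ^ 'n"
  assumes "tame c C A"
  shows "norm A \<le> real CARD('n) * (real CARD('n) * C)"
proof -
  have "norm A \<le> (\<Sum>i\<in>UNIV. norm (A $ i))"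
    unfolding norm_vec_def[of A] by (rule L2_set_le_sum) auto
  also have "\<dots> \<le> (\<Sum>i\<in>(UNIV :: 'n set). \<Sum>j\<in>(UNIV :: 'n set). \<bar>A $ i $ j\<bar>)"
    by (intro sum_mono norm_le_l1_cart)
  also have "\<dots> \<le> (\<Sum>i\<in>(UNIV :: 'n set). \<Sum>j\<in>(UNIV :: 'n set). C)"
    using assms by (intro sum_mono) (auto simp: tame_def nonneg_mat_def)
  finally show ?thesis by simp
qed

lemma tame_convergent_subsequence:
  fixes f :: "nat \<Rightarrow> real ^ 'n ^ 'n"
  assumes "\<And>k. tame c C (f k)"
  obtains r L where "strict_mono r" "(\<lambda>k. f (r k)) \<longlonglongrightarrow> L"
proof -
  have "bounded (range f)"
    unfolding bounded_iff using tame_norm_le[OF assms] by auto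
  from bounded_imp_convergent_subsequence[OF this] show ?thesis
    using that by (auto simp: o_def)
qed

lemma tame_limit:
  assumes lim: "f \<longlonglongrightarrow> A" and tame: "\<forall>\<^sub>F n in sequentially. tame c C (f n)"
  shows "tame c C A"
proof -
  have lim': "(\<lambda>n. f n $ i $ j) \<longlonglongrightarrow> A $ i $ j" for i j
    by (intro tendsto_intros lim)
  have "nonneg_mat A"
    using tame by (intro nonneg_mat_limit[OF lim]) (auto elim: eventually_mono simp: tame_def)
  moreover have "A $ i $ j \<le> C" for i j
    using tame by (intro tendsto_upperbound[OF lim']) (auto elim: eventually_mono simp: tame_def)
  moreover have "c \<le> A $ i $ i" for i
    using tame by (intro tendsto_lowerbound[OF lim']) (auto elim: eventually_mono simp: tame_def)
  ultimately show ?thesis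
    by (simp add: tame_def)
qed

text \<open>
  The powers of \<open>E\<close> stay in a compact set of invertible matrices, hence are recurrent: along a
  subsequence the quotients \<open>E ** matpow E (s k)\<close> of consecutive terms tend to the identity. So \<open>E\<close> has
  the inverse \<open>H\<close>, a limit of powers of \<open>E\<close> and thus nonnegative with positive diagonal. The
  off-diagonal entries of \<open>E ** H\<close> vanish, which forces those of \<open>E\<close> to vanish, and a diagonal matrix
  with entries in \<open>[0, 1]\<close> and determinant \<open>\<plusminus>1\<close> is the identity.
\<close>

lemma eq_one_if_powers_tame:
  fixes E :: "real ^ 'n ^ 'n"
  assumes tame: "\<And>a. tame c C (matpow E a)" and c: "c > 0"
    and det: "\<bar>det E\<bar> = 1" and diag: "\<And>i. E $ i $ i \<le> 1"
  shows "E = mat 1"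
proof -
  obtain r F where r: "strict_mono r" and F: "(\<lambda>k. matpow E (r k)) \<longlonglongrightarrow> F"
    using tame_convergent_subsequence[of c C "matpow E"] tame by blast
  define s where "s k = r (Suc k) - Suc (r k)" for k
  have r_Suc: "r (Suc k) = r k + Suc (s k)" for k
    using strict_monoD[OF r, of k "Suc k"] by (simp add: s_def)
  obtain q H where q: "strict_mono q" and H: "(\<lambda>k. matpow E (s (q k))) \<longlonglongrightarrow> H"
    using tame_convergent_subsequence[of c C "\<lambda>k. matpow E (s k)"] tame by blast
  have F1: "(\<lambda>k. matpow E (r (q k))) \<longlonglongrightarrow> F"
    using LIMSEQ_subseq_LIMSEQ[OF F q] by (simp add: o_def)
  have "(\<lambda>k. matpow E (r (Suc (q k)))) \<longlonglongrightarrow> F"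
    using LIMSEQ_subseq_LIMSEQ[OF LIMSEQ_Suc[OF F] q] by (simp add: o_def)
  moreover have "(\<lambda>k. matpow E (r (Suc (q k)))) \<longlonglongrightarrow> F ** (E ** H)"
    unfolding r_Suc matpow_add using F1 H
    by (auto intro!: matrix_mult.tendsto)
  ultimately have FEH: "F = F ** (E ** H)"
    by (rule LIMSEQ_unique)
  have "(\<lambda>k. \<bar>det (matpow E (r k))\<bar>) \<longlonglongrightarrow> \<bar>det F\<bar>"
    by (intro tendsto_intros tendsto_det F)
  then have "\<bar>det F\<bar> = 1"
    using det by (simp add: det_matpow power_abs LIMSEQ_const_iff)
  then have "invertible F"
    by (auto simp: invertible_det_nz)
  then obtain F' where "F' ** F = mat 1"
    unfolding invertible_def by blast
  then have EH: "E ** H = mat 1"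
    using FEH by (metis matrix_mul_assoc matrix_mul_lid)
  have E: "nonneg_mat E"
    using tame[of 1] by (simp add: tame_def)
  have H_tame: "tame c C H"
    using tame by (intro tame_limit[OF H]) auto
  have off: "E $ i $ j = 0" if "i \<noteq> j" for i j
  proof -
    have "E $ i $ j * H $ j $ j \<le> (E ** H) $ i $ j"
      using E H_tame by (intro mult_entry_ge) (auto simp: tame_def)
    also have "\<dots> = 0"
      using that by (simp add: EH mat_def)
    finally have "E $ i $ j * H $ j $ j \<le> 0" .
    moreover have "H $ j $ j > 0"
      using H_tame c by (auto simp: tame_def intro: less_le_trans)
    ultimately have "E $ i $ j \<le> 0"
      by (simp add: mult_le_0_iff)
    then show ?thesis
      using E by (auto simp: nonneg_mat_def intro: antisym)
  qed
  have E01: "0 \<le> E $ i $ i" "E $ i $ i \<le> 1" for i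
    using E diag by (auto simp: nonneg_mat_def)
  have prod1: "(\<Prod>i\<in>UNIV. E $ i $ i) = 1"
    using det det_diagonal[of E] off E01 by (simp add: abs_prod)
  have "E $ i $ i = 1" for i
  proof -
    have "1 = E $ i $ i * (\<Prod>j\<in>UNIV - {i}. E $ j $ j)"
      unfolding prod1[symmetric] by (rule prod.remove) auto
    also have "\<dots> \<le> E $ i $ i * 1"
      using E01 by (intro mult_left_mono prod_le_1) auto
    finally show ?thesis
      using E01[of i] by simp
  qed
  then show ?thesis
    using off by (auto simp: vec_eq_iff mat_def)
qed

text \<open>
  Otherwise roots \<open>G k\<close> of growing order \<open>p k\<close> that stay away from the identity have a limit point \<open>E\<close>.
  Each fixed power of \<open>E\<close> is a limit of tame matrices, and \<open>\<bar>det E\<bar>\<close> and \<open>E $ i $ i\<close> are controlled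
  by the roots of order \<open>p k\<close> of \<open>det B\<close> and \<open>B $ i $ i\<close>, which tend to 1. Hence \<open>E\<close> is the identity.
\<close>

lemma tame_roots_near_one:
  fixes B :: "real ^ 'n ^ 'n"
  assumes c: "c > 0" and det: "det B > 0" and e: "e > 0"
  obtains m where "\<And>n G. n \<ge> m \<Longrightarrow> tame_root c C B n G \<Longrightarrow> norm (G - mat 1) < e"
proof (rule ccontr)
  assume contra: "\<not> thesis"
  have "\<exists>n G. n \<ge> Suc k \<and> tame_root c C B n G \<and> norm (G - mat 1) \<ge> e" for k
    using contra that[of "Suc k"] by (meson not_le)
  then obtain p G where p: "\<And>k. p k \<ge> Suc k" and G: "\<And>k. tame_root c C B (p k) (G k)"
    and far: "\<And>k. norm (G k - mat 1) \<ge> e"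
    by metis
  have G_tame: "tame c C (matpow (G k) a)" if "a \<le> p k" for k a
    using G that by (auto simp: tame_root_def)
  have G_root: "matpow (G k) (p k) = B" for k
    using G by (auto simp: tame_root_def)
  have "tame c C (G k)" for k
    using G_tame[of 1 k] p[of k] by simp
  then obtain r E where r: "strict_mono r" and E: "(\<lambda>k. G (r k)) \<longlonglongrightarrow> E"
    using tame_convergent_subsequence by blast
  have "k \<le> p (r k)" for k
    using p[of "r k"] seq_suble[OF r, of k] by linarith
  then have pr: "filterlim (\<lambda>k. p (r k)) at_top sequentially"
    by (intro filterlim_at_top_mono[OF filterlim_ident]) auto
  have root_lim: "(\<lambda>k. root (p (r k)) x) \<longlonglongrightarrow> 1" if "x > 0" for x
    by (rule filterlim_compose[OF LIMSEQ_root_const[OF that] pr])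
  have "E = mat 1"
  proof (rule eq_one_if_powers_tame[OF _ c])
    show "tame c C (matpow E a)" for a
    proof (rule tame_limit[OF tendsto_matpow[OF E]])
      show "\<forall>\<^sub>F k in sequentially. tame c C (matpow (G (r k)) a)"
        using filterlim_at_top[THEN iffD1, OF pr, rule_format, of a]
        by eventually_elim (rule G_tame)
    qed
    have "\<bar>det (G k)\<bar> = root (p k) (det B)" for k
    proof -
      have "\<bar>det (G k)\<bar> ^ p k = det B"
        using arg_cong[OF G_root[of k], of "\<lambda>X. \<bar>det X\<bar>"] det
        by (simp add: det_matpow power_abs)
      then show ?thesis
        using p[of k] by (metis abs_ge_zero real_root_power_cancel Suc_le_eq gr_zeroI not_less0)
    qed
    then have "(\<lambda>k. \<bar>det (G (r k))\<bar>) \<longlonglongrightarrow> 1"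
      using root_lim[OF det] by simp
    moreover have "(\<lambda>k. \<bar>det (G (r k))\<bar>) \<longlonglongrightarrow> \<bar>det E\<bar>"
      by (intro tendsto_intros tendsto_det E)
    ultimately show "\<bar>det E\<bar> = 1"
      using LIMSEQ_unique by blast
    show "E $ i $ i \<le> 1" for i
    proof (rule LIMSEQ_le)
      show "(\<lambda>k. G (r k) $ i $ i) \<longlonglongrightarrow> E $ i $ i"
        by (intro tendsto_intros E)
      have "c \<le> B $ i $ i"
        using G_tame[of "p 0" 0] by (simp add: G_root tame_def)
      then show "(\<lambda>k. root (p (r k)) (B $ i $ i)) \<longlonglongrightarrow> 1"
        using c by (intro root_lim) linarith
      have "G k $ i $ i \<le> root (p k) (B $ i $ i)" for k
      proof -
        have "nonneg_mat (G k)"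
          using \<open>tame c C (G k)\<close> by (simp add: tame_def)
        then have "root (p k) ((G k $ i $ i) ^ p k) \<le> root (p k) (B $ i $ i)" "0 \<le> G k $ i $ i"
          using matpow_diag_ge[of "G k" i "p k"] p[of k] by (auto simp: G_root nonneg_mat_def)
        then show ?thesis
          using p[of k] by (simp add: real_root_power_cancel)
      qed
      then show "\<exists>N. \<forall>k\<ge>N. G (r k) $ i $ i \<le> root (p (r k)) (B $ i $ i)"
        by blast
    qed
  qed
  have "(\<lambda>k. norm (G (r k) - mat 1)) \<longlonglongrightarrow> norm (E - mat 1)"
    by (intro tendsto_intros E)
  then have "norm (E - mat 1) \<ge> e"
    by (rule tendsto_lowerbound) (simp_all add: far)
  then show False
    using \<open>E = mat 1\<close> e by simp
qed

section \<open>A logarithm from dyadic roots\<close>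

text \<open>
  For \<open>x = norm (J - mat 1)\<close> the identity \<open>J ** J - 1 = 2 (J - 1) + (J - 1) ** (J - 1)\<close> gives
  \<open>norm (J ** J - mat 1) \<ge> 2 * x - x\<^sup>2 = 1 - (1 - x)\<^sup>2\<close>. The function \<open>- ln (1 - x)\<close> is chosen
  because it turns this into an exact doubling, with no error terms to accumulate.
\<close>

lemma ln_one_minus_norm_doubling:
  fixes J :: "real ^ 'n ^ 'n"
  assumes "norm (J - mat 1) < 1" "norm (J ** J - mat 1) < 1"
  shows "2 * - ln (1 - norm (J - mat 1)) \<le> - ln (1 - norm (J ** J - mat 1))"
proof -
  define X where "X = J - mat 1"
  have "J ** J - mat 1 = 2 *\<^sub>R X + X ** X"
    by (simp add: X_def matrix_mult.diff_left matrix_mult.diff_right scaleR_2)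
  then have "norm (2 *\<^sub>R X) \<le> norm (J ** J - mat 1) + norm (X ** X)"
    using norm_triangle_ineq4[of "2 *\<^sub>R X + X ** X" "X ** X"] by simp
  then have "2 * norm X - norm X * norm X \<le> norm (J ** J - mat 1)"
    using norm_matrix_mult_le[of X X] by simp
  then have "1 - norm (J ** J - mat 1) \<le> (1 - norm X) ^ 2"
    by (simp add: power2_eq_square algebra_simps)
  then have "ln (1 - norm (J ** J - mat 1)) \<le> ln ((1 - norm X) ^ 2)"
    using assms by (subst ln_le_cancel_iff) (auto simp: X_def)
  then show ?thesis
    using assms by (simp add: X_def ln_realpow)
qed

text \<open>
  Once all tame roots of order at least \<open>2 ^ m\<close> are within 1/2 of the identity, repeated squaring from
  order \<open>2 ^ l\<close> down to order \<open>2 ^ m\<close> never leaves that ball, and each squaring at least doubles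
  \<open>- ln (1 - x)\<close>. So the root of order \<open>2 ^ l\<close> has distance \<open>O(1 / 2 ^ l)\<close> from the identity.
\<close>

lemma tame_dyadic_roots_bound:
  fixes B :: "real ^ 'n ^ 'n"
  assumes c: "c > 0" and det: "det B > 0"
  obtains m M where
    "\<And>l J. l \<ge> m \<Longrightarrow> tame_root c C B (2 ^ l) J \<Longrightarrow> 2 ^ l * norm (J - mat 1) \<le> M"
proof -
  obtain m where near: "\<And>n G. n \<ge> m \<Longrightarrow> tame_root c C B n G \<Longrightarrow> norm (G - mat 1) < 1 / 2"
    using tame_roots_near_one[OF c det half_gt_zero[OF zero_less_one], of C] by blast
  define w where "w J = - ln (1 - norm (J - mat 1))" for J :: "real ^ 'n ^ 'n"
  have "tame_root c C B (2 ^ l) J \<Longrightarrow> 2 ^ l * w J \<le> 2 ^ m * ln 2" if "l \<ge> m" for l J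
    using that
  proof (induction l arbitrary: J rule: dec_induct)
    case base
    have "norm (J - mat 1) < 1 / 2"
      using near[OF _ base] by simp
    then have "ln (1 / 2) \<le> ln (1 - norm (J - mat 1))"
      by (subst ln_le_cancel_iff) auto
    then have "w J \<le> ln 2"
      by (simp add: w_def ln_div)
    then show ?case
      by simp
  next
    case (step l)
    have J2: "tame_root c C B (2 ^ l) (J ** J)"
      using tame_root_matpow[of c C B "2 ^ l" 2 J] step.prems by (simp add: mult.commute numeral_2_eq_2)
    have le: "m \<le> 2 ^ k" if "m \<le> k" for k
      using that less_exp[of k] by linarith
    have "norm (J - mat 1) < 1 / 2" "norm (J ** J - mat 1) < 1 / 2"
      using near[OF le step.prems] near[OF le J2] step.hyps by auto
    then have "2 * w J \<le> w (J ** J)"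
      unfolding w_def by (intro ln_one_minus_norm_doubling) auto
    then have "2 ^ Suc l * w J \<le> 2 ^ l * w (J ** J)"
      by simp
    also have "\<dots> \<le> 2 ^ m * ln 2"
      by (rule step.IH[OF J2])
    finally show ?case .
  qed
  \<comment> \<open>the logarithmic quantity dominates the distance, by \<open>ln t \<le> t - 1\<close>\<close>
  moreover have "norm (J - mat 1) \<le> w J" if "l \<ge> m" "tame_root c C B (2 ^ l) J" for l J
  proof -
    have "norm (J - mat 1) < 1 / 2"
      using near[OF _ that(2)] that(1) less_exp[of l] by linarith
    then show ?thesis
      using ln_le_minus_one[of "1 - norm (J - mat 1)"] by (simp add: w_def)
  qed
  ultimately have "2 ^ l * norm (J - mat 1) \<le> 2 ^ m * ln 2"
    if "l \<ge> m" "tame_root c C B (2 ^ l) J" for l J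
    using that by (meson mult_left_mono order_trans zero_le_numeral zero_le_power)
  then show ?thesis
    using that by blast
qed

text \<open>
  Writing the root of order \<open>2 ^ l\<close> as \<open>1 + A / 2 ^ l\<close>, the matrices \<open>A\<close> are bounded, and any limit point
  is a logarithm of \<open>B\<close>. Its off-diagonal entries are limits of multiples of entries of nonnegative
  matrices. To have tame roots, these are the \<open>D\<close>-th powers of nonnegative roots of order \<open>D * 2 ^ l\<close>.
\<close>

lemma log_of_strongly_infinitely_divisible:
  fixes B :: "real ^ 'n ^ 'n"
  assumes "strongly_infinitely_divisible B"
  shows "\<exists>Q. Z_matrix Q \<and> mat_exp (- Q) = B"
proof -
  have det: "det B > 0"
    using assms by (simp add: strongly_infinitely_divisible_def)
  obtain K where K: "\<And>n. n \<ge> 1 \<Longrightarrow> nonneg_mat (K n)" "\<And>n. n \<ge> 1 \<Longrightarrow> matpow (K n) n = B"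
    using assms unfolding strongly_infinitely_divisible_def infinitely_divisible_def by blast
  obtain D where D: "D > 0" "\<And>\<sigma>. \<sigma> permutes (UNIV :: 'n set) \<Longrightarrow> \<sigma> ^^ D = id"
    using common_permutation_exponent by blast
  obtain c C where c: "c > 0" and tame:
    "\<And>K n. n > 0 \<Longrightarrow> nonneg_mat K \<Longrightarrow> matpow K (D * n) = B \<Longrightarrow> tame_root c C B n (matpow K D)"
    using powers_of_roots_are_tame[OF det D] by blast
  define J where "J l = matpow (K (D * 2 ^ l)) D" for l
  have J: "tame_root c C B (2 ^ l) (J l)" for l
    unfolding J_def using K[of "D * 2 ^ l"] D(1) by (intro tame) auto
  obtain m M where M:
    "\<And>l J. l \<ge> m \<Longrightarrow> tame_root c C B (2 ^ l) J \<Longrightarrow> 2 ^ l * norm (J - mat 1) \<le> M"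
    using tame_dyadic_roots_bound[OF c det] by blast
  \<comment> \<open>the shift by \<open>m\<close> skips the orders for which the bound \<open>M\<close> is not available\<close>
  define A where "A l = 2 ^ (l + m) *\<^sub>R (J (l + m) - mat 1)" for l
  have "norm (A l) \<le> M" for l
    using M[OF _ J[of "l + m"]] by (simp add: A_def)
  then have "bounded (range A)"
    unfolding bounded_iff by blast
  then obtain r L where r: "strict_mono r" and L: "(\<lambda>k. A (r k)) \<longlonglongrightarrow> L"
    using bounded_imp_convergent_subsequence[of A] by (auto simp: o_def)
  have "mat_exp L = B"
  proof (rule LIMSEQ_unique)
    define p :: "nat \<Rightarrow> nat" where "p k = 2 ^ (r k + m)" for k
    have "strict_mono p"
      using r by (auto simp: strict_mono_def p_def)
    then show "(\<lambda>k. matpow (mat 1 + (1 / real (p k)) *\<^sub>R A (r k)) (p k)) \<longlonglongrightarrow> mat_exp L"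
      by (intro mat_exp_limit L filterlim_subseq)
    have "matpow (mat 1 + (1 / real (p k)) *\<^sub>R A (r k)) (p k) = B" for k
      using J[of "r k + m"] by (simp add: A_def p_def tame_root_def)
    then show "(\<lambda>k. matpow (mat 1 + (1 / real (p k)) *\<^sub>R A (r k)) (p k)) \<longlonglongrightarrow> B"
      by simp
  qed
  moreover have "Z_matrix (- L)"
    unfolding Z_matrix_def
  proof (intro allI impI)
    fix i j :: 'n assume "i \<noteq> j"
    have "0 \<le> J l $ i $ j" for l
      using J[of l] by (force simp: tame_root_def tame_def nonneg_mat_def dest: spec[of _ 1])
    then have "0 \<le> A l $ i $ j" for l
      using \<open>i \<noteq> j\<close> by (simp add: A_def mat_def)
    moreover have "(\<lambda>k. A (r k) $ i $ j) \<longlonglongrightarrow> L $ i $ j"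
      by (intro tendsto_intros L)
    ultimately have "0 \<le> L $ i $ j"
      by (intro LIMSEQ_le_const) auto
    then show "(- L) $ i $ j \<le> 0"
      by simp
  qed
  ultimately show ?thesis
    by (intro exI[of _ "- L"]) simp
qed

theorem theorem1:
  fixes B :: "real ^ 'n ^ 'n"
  assumes "nonneg_mat B"
  shows "strongly_infinitely_divisible B \<longleftrightarrow>
         (\<exists>Q :: real ^ 'n ^ 'n. Z_matrix Q \<and> mat_exp (- Q) = B)"
proof
  show "\<exists>Q. Z_matrix Q \<and> mat_exp (- Q) = B" if "strongly_infinitely_divisible B"
    using that by (rule log_of_strongly_infinitely_divisible)
  show "strongly_infinitely_divisible B" if "\<exists>Q. Z_matrix Q \<and> mat_exp (- Q) = B"
    using that by (auto intro: strongly_infinitely_divisible_mat_exp)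
qed

end
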